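(* Let $\nu,\beta\in]0,+\infty[$ and $p\in[1,+\infty[$ with $\nu-p(\nu-\beta)>0$, and let $\alpha>0$. Suppose that the Bishop type inequality described in the context holds, and assume either $\nu\ge\alpha$ and $q\ge1$, or $\nu<\alpha$ and $q>\alpha/\nu$. Then for any $f\in M_{\alpha,q}$ we have $|f|\,d\mathfrak m\in K_{\nu,\beta}^{\,p}$ if $q>\alpha/(\nu-p(\nu-\beta))$, where $f\in M_{\alpha,q}$ means that $f$ is a measurable function on $E$ with $$\sup_{x\in E}\int_{d(x,y)\le1}\frac{|f(y)|^q}{d(x,y)^{\nu-\alpha}}\,\mathfrak m(dy)<+\infty.$$
   Context: Notation: $]a,b[$ denotes an open interval; "increasing" is in the wide (non-strict) sense. $(E,d)$ is a locally compact separable metric space, $\mathfrak m$ is a positive Radon measure on $E$ with full support, $B_r(x)=\{y\in E: d(x,y)<r\}$. Bishop type inequality: for a fixed increasing positive function $V$ on $]0,+\infty[$, the map $r\mapsto V(r)/r^\nu$ is increasing or bounded, and $\sup_{x\in E}\mathfrak m(B_r(x))\le V(r)$ for all $r>0$. Class $K_{\nu,\beta}^{\,p}$: put $G(r)=r^{\beta-\nu}$ for $r\in]0,+\infty[$ if $\nu>\beta$, $G(r)=\log(r^{-1})$ for $r\in]0,1[$ if $\nu=\beta$, $G(0)=+\infty$, and $G(x,y)=G(d(x,y))$. $K_{\nu,\beta}^{\,p}$ is the set of positive Borel measures $\mu$ on $E$ such that: if $\nu\ge\beta$, $\lim_{r\to0}\sup_{x\in E}\int_{d(x,y)<r}G(x,y)^p\mu(dy)=0$;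 if $\nu<\beta$, $\sup_{x\in E}\int_{d(x,y)\le1}\mu(dy)<+\infty$. *)

theory Defs
  imports "HOL-Analysis.Analysis"
begin

definition radon_measure :: "'a::topological_space measure \<Rightarrow> bool" where
  "radon_measure M \<longleftrightarrow>
     sets M = sets borel \<and>
     (\<forall>K. compact K \<longrightarrow> emeasure M K < \<infinity>) \<and>
     (\<forall>A\<in>sets M. emeasure M A = (INF U\<in>{U. open U \<and> A \<subseteq> U}. emeasure M U)) \<and>
     (\<forall>U. open U \<longrightarrow> emeasure M U = (SUP K\<in>{K. compact K \<and> K \<subseteq> U}. emeasure M K))"

definition full_support :: "'a::topological_space measure \<Rightarrow> bool" where
  "full_support M \<longleftrightarrow> (\<forall>U. open U \<and> U \<noteq> {} \<longrightarrow> emeasure M U > 0)"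

definition bishop_inequality ::
    "'a::metric_space measure \<Rightarrow> real \<Rightarrow> (real \<Rightarrow> real) \<Rightarrow> bool" where
  "bishop_inequality m \<nu> V \<longleftrightarrow>
     mono_on {0<..} V \<and> (\<forall>r>0. V r > 0) \<and>
     (mono_on {0<..} (\<lambda>r. V r / r powr \<nu>) \<or> bounded ((\<lambda>r. V r / r powr \<nu>) ` {0<..})) \<and>
     (\<forall>r>0. (SUP x. emeasure m (ball x r)) \<le> ennreal (V r))"

(* Real powers on [0,\<infinity>].  Unlike powr, where 0 powr s = 0 for every s, negative powers of 0
   are \<infinity> and a^0 = 1. *)
definition epowr :: "ennreal \<Rightarrow> real \<Rightarrow> ennreal" where
  "epowr a s =
     (if s = 0 then 1
      else if a = 0 then (if s < 0 then \<infinity> else 0)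
      else if a = \<infinity> then (if s < 0 then 0 else \<infinity>)
      else ennreal (enn2real a powr s))"

(* Only used for \<nu> \<ge> \<beta>.  For \<nu> = \<beta> the mathematical G is defined on [0,1[ only; here it is
   extended by 0, as ennreal sends negative reals to 0. *)
definition kato_G :: "real \<Rightarrow> real \<Rightarrow> real \<Rightarrow> ennreal" where
  "kato_G \<nu> \<beta> r =
     (if r = 0 then \<infinity>
      else if \<nu> > \<beta> then ennreal (r powr (\<beta> - \<nu>))
      else ennreal (ln (1 / r)))"

definition kato_class :: "real \<Rightarrow> real \<Rightarrow> real \<Rightarrow> 'a::metric_space measure set" where
  "kato_class \<nu> \<beta> p = {\<mu>. sets \<mu> = sets borel \<and>
     (if \<nu> \<ge> \<beta>
      then ((\<lambda>r. SUP x. \<integral>\<^sup>+y\<in>{y. dist x y < r}. epowr (kato_G \<nu> \<beta> (dist x y)) p \<partial>\<mu>)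
              \<longlongrightarrow> 0) (at_right 0)
      else (SUP x. \<integral>\<^sup>+y\<in>{y. dist x y \<le> 1}. 1 \<partial>\<mu>) < \<infinity>)}"

definition M_class ::
    "'a::metric_space measure \<Rightarrow> real \<Rightarrow> real \<Rightarrow> real \<Rightarrow> ('a \<Rightarrow> real) set" where
  "M_class m \<nu> \<alpha> q = {f. f \<in> borel_measurable borel \<and>
     (SUP x. \<integral>\<^sup>+y\<in>{y. dist x y \<le> 1}.
        ennreal (\<bar>f y\<bar> powr q) / epowr (ennreal (dist x y)) (\<nu> - \<alpha>) \<partial>m) < \<infinity>}"

end

theory Submission
  imports Defs
begin

text \<open>
  Write \<open>d\<close> for the distance to a fixed centre, and call an integral bounded when its bound does
  not depend on that centre. The Bishop inequality gives balls of small radius \<open>r\<close> a mass of order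
  at most \<open>r powr \<nu>\<close>, so the integral of \<open>d powr -e\<close> over unit balls is bounded whenever \<open>e < \<nu>\<close>
  (lemma \<open>nn_integral_dist_powr_bounded\<close>, by summing over dyadic shells).

  The heart of the proof is \<open>M_class_potential_bounded\<close>: for \<open>f\<close> in \<open>M_class m \<nu> \<alpha> q\<close> with
  \<open>q > 1\<close>, the integral of \<open>\<bar>f\<bar> * d powr -s\<close> over unit balls is bounded as soon as \<open>s + \<alpha> / q < \<nu>\<close>.
  Young's inequality separates the integrand into \<open>\<bar>f\<bar> powr q * d powr (\<alpha> - \<nu>)\<close>, which the class
  controls, and a pure power \<open>d powr -e\<close>; the condition on \<open>s\<close> says exactly that \<open>e < \<nu>\<close>. For
  \<open>q = 1\<close> the first term alone dominates, and \<open>s + \<alpha> \<le> \<nu>\<close> suffices.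

  If \<open>\<nu> < \<beta>\<close>, the Kato condition is this bound with \<open>s = 0\<close>. If \<open>\<nu> \<ge> \<beta>\<close>, put
  \<open>\<sigma> = p * (\<nu> - \<beta>)\<close>; near the diagonal the \<open>p\<close>-th power of the kernel \<open>G\<close> is of order at most
  \<open>d powr -(\<sigma> + \<delta>)\<close> for every \<open>\<delta> > 0\<close>, the loss \<open>\<delta>\<close> absorbing the logarithm when \<open>\<nu> = \<beta>\<close>.
  The hypothesis \<open>q > \<alpha> / (\<nu> - \<sigma>)\<close> is strict, so there is room for a second \<open>\<delta>\<close>: the bound
  holds with \<open>s = \<sigma> + 2 * \<delta>\<close>. On a ball of radius \<open>r < 1\<close>,
  \<open>d powr -(\<sigma> + \<delta>) \<le> r powr \<delta> * d powr -s\<close>, so the Kato integral is of order at most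
  \<open>r powr \<delta>\<close> and tends to \<open>0\<close> uniformly in the centre. The diagonal, where the kernel is
  infinite, is negligible because growth of balls rules out atoms.
\<close>

section \<open>Polynomial growth of balls\<close>

text \<open>
  Radii go up to 2 so that the closed unit ball is covered: the shell
  \<open>2 powr -(k + 1) < d \<le> 2 powr -k\<close> lies in the open ball of radius \<open>2 * 2 powr -k\<close>.
\<close>

definition ball_growth :: "'a::metric_space measure \<Rightarrow> real \<Rightarrow> real \<Rightarrow> bool" where
  "ball_growth m \<nu> C \<longleftrightarrow>
     C \<ge> 0 \<and> (\<forall>x r. 0 < r \<longrightarrow> r \<le> 2 \<longrightarrow> emeasure m (ball x r) \<le> ennreal (C * r powr \<nu>))"

lemma ball_growthD:
  assumes "ball_growth m \<nu> C"
  shows "C \<ge> 0" and "0 < r \<Longrightarrow> r \<le> 2 \<Longrightarrow> emeasure m (ball x r) \<le> ennreal (C * r powr \<nu>)"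
  using assms by (auto simp: ball_growth_def)

text \<open>
  Either alternative in the Bishop inequality bounds \<open>V r / r powr \<nu>\<close> for \<open>r \<le> 2\<close>: a monotone
  ratio is at most its value at 2.
\<close>

lemma bishop_growth_bound:
  fixes m :: "'a::metric_space measure"
  assumes "bishop_inequality m \<nu> V"
  obtains C where "ball_growth m \<nu> C"
proof -
  have Vb: "emeasure m (ball x r) \<le> ennreal (V r)" if "r > 0" for x r
  proof -
    have "emeasure m (ball x r) \<le> (SUP x. emeasure m (ball x r))" by (rule SUP_upper) simp
    also have "\<dots> \<le> ennreal (V r)"
      using assms that by (simp only: bishop_inequality_def)
    finally show ?thesis .
  qed
  have Vpos: "V r > 0" if "r > 0" for r
    using assms that unfolding bishop_inequality_def by auto
  obtain C where C: "\<And>r. 0 < r \<Longrightarrow> r \<le> 2 \<Longrightarrow> V r / r powr \<nu> \<le> C"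
  proof (cases "mono_on {0<..} (\<lambda>r. V r / r powr \<nu>)")
    case True
    then show ?thesis by (intro that[of "V 2 / 2 powr \<nu>"]) (auto simp: mono_on_def)
  next
    case False
    then have "bounded ((\<lambda>r. V r / r powr \<nu>) ` {0<..})"
      using assms unfolding bishop_inequality_def by auto
    then obtain B where "\<forall>y\<in>(\<lambda>r. V r / r powr \<nu>) ` {0<..}. norm y \<le> B"
      by (auto simp: bounded_iff)
    then have "\<bar>V r / r powr \<nu>\<bar> \<le> B" if "0 < r" for r
      using that by simp
    then have "V r / r powr \<nu> \<le> B" if "0 < r" for r
      using that by (blast intro: order_trans[OF abs_ge_self])
    then show ?thesis by (intro that[of B]) auto
  qed
  have "ball_growth m \<nu> C"
    unfolding ball_growth_def
  proof (intro conjI allI impI)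
    show "C \<ge> 0" using C[of 1] Vpos[of 1] by simp
    fix x :: 'a and r :: real assume r: "0 < r" "r \<le> 2"
    have "V r \<le> C * r powr \<nu>" using C[OF r] r by (simp add: divide_simps)
    then show "emeasure m (ball x r) \<le> ennreal (C * r powr \<nu>)"
      by (rule order_trans[OF Vb[OF r(1)] ennreal_leI])
  qed
  then show thesis by (rule that)
qed

text \<open>
  The kernel \<open>G\<close> is infinite on the diagonal, and negative powers of 0 vanish under
  \<^const>\<open>powr\<close>; absence of atoms makes this discrepancy invisible to integrals.
\<close>

lemma emeasure_singleton_zero_of_growth:
  fixes m :: "'a::metric_space measure"
  assumes sets: "sets m = sets borel" and "\<nu> > 0"
    and growth: "ball_growth m \<nu> C"
  shows "emeasure m {x} = 0"
proof -
  have "((\<lambda>r. ennreal (C * r powr \<nu>)) \<longlongrightarrow> ennreal (C * 0 powr \<nu>)) (at_right 0)"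
    using \<open>\<nu> > 0\<close>
    by (intro tendsto_intros tendsto_ennrealI) (auto intro: eventually_at_rightI[of 0 1])
  moreover have "eventually (\<lambda>r. emeasure m {x} \<le> ennreal (C * r powr \<nu>)) (at_right 0)"
  proof (rule eventually_at_rightI[of 0 2])
    fix r :: real assume r: "r \<in> {0<..<2}"
    have "emeasure m {x} \<le> emeasure m (ball x r)"
      using r by (intro emeasure_mono) (auto simp: sets)
    also have "\<dots> \<le> ennreal (C * r powr \<nu>)" using r by (intro ball_growthD(2)[OF growth]) auto
    finally show "emeasure m {x} \<le> ennreal (C * r powr \<nu>)" .
  qed simp
  ultimately have "emeasure m {x} \<le> ennreal (C * 0 powr \<nu>)"
    by (intro tendsto_lowerbound) auto
  then show ?thesis by simp
qed

section \<open>Integrability of negative powers of the distance\<close>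

text \<open>
  Here \<open>k\<close> is the integer part of \<open>- log 2 d\<close>. The ratio \<open>d / 2 powr -k\<close> lies between 1/2 and 1,
  so its power costs a factor at most \<open>2 powr \<bar>e\<bar>\<close>, whatever the sign of \<open>e\<close>.
\<close>

lemma powr_le_dyadic:
  fixes d e :: real
  assumes "0 < d" "d \<le> 1"
  obtains k :: nat where "d < 2 * 2 powr - real k"
    and "d powr -e \<le> 2 powr \<bar>e\<bar> * 2 powr (real k * e)"
proof -
  define k where "k = nat \<lfloor>- log 2 d\<rfloor>"
  define u where "u = - log 2 d"
  have "u \<ge> 0" using assms by (simp add: u_def)
  then have k: "real k \<le> u" "u < real k + 1" unfolding k_def u_def by linarith+
  have d: "d = 2 powr - u" using assms by (simp add: u_def)
  show thesis
  proof
    have "2 * 2 powr - real k = (2::real) powr (1 - real k)" by (simp add: powr_diff powr_minus divide_simps)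
    then show "d < 2 * 2 powr - real k" using k unfolding d by simp
    have "u * e - real k * e = (u - real k) * e" by (simp add: algebra_simps)
    also have "\<dots> \<le> (u - real k) * \<bar>e\<bar>" using k by (intro mult_left_mono) auto
    also have "\<dots> \<le> 1 * \<bar>e\<bar>" using k by (intro mult_right_mono) auto
    finally have "u * e \<le> \<bar>e\<bar> + real k * e" by simp
    then show "d powr -e \<le> 2 powr \<bar>e\<bar> * 2 powr (real k * e)"
      unfolding d by (simp add: powr_powr flip: powr_add)
  qed
qed

lemma borel_measurable_dist_from:
  fixes m :: "'a::metric_space measure"
  assumes "sets m = sets borel"
  shows "(\<lambda>y. dist x y) \<in> borel_measurable m"
proof -
  have "(\<lambda>y. dist x y) \<in> borel_measurable borel"
    by (intro borel_measurable_continuous_onI continuous_intros)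
  then show ?thesis by (simp add: measurable_cong_sets[OF assms refl])
qed

text \<open>
  The shell of radius about \<open>2 powr -k\<close> contributes at most a constant times
  \<open>2 powr (k * e)\<close> times \<open>2 powr (- k * \<nu>)\<close>: a geometric series with ratio
  \<open>2 powr (e - \<nu>) < 1\<close>, whose sum is the same for all centres.
\<close>

lemma nn_integral_dist_powr_bounded:
  fixes m :: "'a::metric_space measure"
  assumes sets: "sets m = sets borel" and "e < \<nu>"
    and growth: "ball_growth m \<nu> C"
  obtains K where "\<And>x. (\<integral>\<^sup>+y\<in>{y. dist x y \<le> 1}. ennreal (dist x y powr -e) \<partial>m) \<le> ennreal K"
proof -
  have "C \<ge> 0" using growth by (rule ball_growthD)
  define w where "w k = 2 powr \<bar>e\<bar> * 2 powr (real k * e)" for k :: nat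
  define \<rho> where "\<rho> = (2::real) powr (e - \<nu>)"
  have rho: "0 \<le> \<rho>" "\<rho> < 1" using \<open>e < \<nu>\<close> powr_less_mono[of "e - \<nu>" 0 2] by (auto simp: \<rho>_def)
  define D where "D = 2 powr \<bar>e\<bar> * C * 2 powr \<nu>"
  have "D \<ge> 0" using \<open>C \<ge> 0\<close> by (simp add: D_def)
  have [measurable]: "ball x r \<in> sets m" for x r by (simp add: sets)
  have "(\<integral>\<^sup>+y\<in>{y. dist x y \<le> 1}. ennreal (dist x y powr -e) \<partial>m) \<le> ennreal (\<Sum>k. D * \<rho> ^ k)" for x
  proof -
    \<comment> \<open>Whole balls replace the disjoint shells: one suitable term of the series already dominates.\<close>
    have "(\<integral>\<^sup>+y\<in>{y. dist x y \<le> 1}. ennreal (dist x y powr -e) \<partial>m)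
        \<le> (\<integral>\<^sup>+y. (\<Sum>k. ennreal (w k) * indicator (ball x (2 * 2 powr - real k)) y) \<partial>m)"
    proof (intro nn_integral_mono)
      fix y
      show "ennreal (dist x y powr -e) * indicator {y. dist x y \<le> 1} y
        \<le> (\<Sum>k. ennreal (w k) * indicator (ball x (2 * 2 powr - real k)) y)"
      proof (cases "0 < dist x y \<and> dist x y \<le> 1")
        case True
        then obtain k :: nat where k: "dist x y < 2 * 2 powr - real k" "dist x y powr -e \<le> w k"
          using powr_le_dyadic[of "dist x y" e] unfolding w_def by metis
        have "ennreal (dist x y powr -e) * indicator {y. dist x y \<le> 1} y
            \<le> ennreal (w k) * indicator (ball x (2 * 2 powr - real k)) y"
          using k True by (auto intro: ennreal_leI)
        also have "\<dots> \<le> (\<Sum>k. ennreal (w k) * indicator (ball x (2 * 2 powr - real k)) y)"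
          using sum_le_suminf[of "\<lambda>k. ennreal (w k) * indicator (ball x (2 * 2 powr - real k)) y" "{k}"]
          by (simp del: indicator_simps sum_mult_indicator)
        finally show ?thesis .
      next
        case False
        then show ?thesis by (cases "x = y") auto
      qed
    qed
    also have "\<dots> = (\<Sum>k. \<integral>\<^sup>+y. ennreal (w k) * indicator (ball x (2 * 2 powr - real k)) y \<partial>m)"
      by (intro nn_integral_suminf) measurable
    also have "\<dots> = (\<Sum>k. ennreal (w k) * emeasure m (ball x (2 * 2 powr - real k)))"
      by (intro suminf_cong nn_integral_cmult_indicator) simp
    also have "\<dots> \<le> (\<Sum>k. ennreal (D * \<rho> ^ k))"
    proof (intro suminf_le)
      fix k :: nat
      have "2 powr - real k \<le> (2::real) powr 0" by (intro powr_mono) auto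
      then have "ennreal (w k) * emeasure m (ball x (2 * 2 powr - real k))
          \<le> ennreal (w k) * ennreal (C * (2 * 2 powr - real k) powr \<nu>)"
        by (intro mult_left_mono ball_growthD(2)[OF growth]) auto
      also have "\<dots> = ennreal (w k * (C * (2 * 2 powr - real k) powr \<nu>))"
        using \<open>C \<ge> 0\<close> by (simp add: ennreal_mult w_def)
      also have "w k * (C * (2 * 2 powr - real k) powr \<nu>)
          = D * (2 powr (real k * e) * 2 powr (- real k * \<nu>))"
        by (simp add: w_def D_def powr_mult powr_powr)
      also have "2 powr (real k * e) * 2 powr (- real k * \<nu>) = \<rho> ^ k"
        by (simp add: \<rho>_def powr_powr algebra_simps flip: powr_add powr_realpow)
      finally show "ennreal (w k) * emeasure m (ball x (2 * 2 powr - real k)) \<le> ennreal (D * \<rho> ^ k)" .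
    qed auto
    also have "\<dots> = ennreal (\<Sum>k. D * \<rho> ^ k)"
      using rho \<open>D \<ge> 0\<close> by (intro suminf_ennreal2 summable_mult summable_geometric) auto
    finally show ?thesis .
  qed
  then show thesis by (rule that)
qed

section \<open>Potentials of functions of the class\<close>

text \<open>
  The weight is distributed as \<open>u * v\<close> with \<open>u = a * d powr (- \<gamma> / q)\<close>, so that \<open>u powr q\<close> carries
  precisely the weight \<open>d powr -\<gamma>\<close>; Young's inequality with the conjugate exponent
  \<open>q / (q - 1)\<close> then leaves a pure power of \<open>d\<close>.
\<close>

lemma young_weight_split:
  fixes a d s \<gamma> q :: real
  assumes "a \<ge> 0" "d > 0" "q > 1"
  shows "a * d powr -s \<le> a powr q * d powr -\<gamma> + d powr - ((q * s - \<gamma>) / (q - 1))"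
proof -
  define u where "u = a * d powr (- \<gamma> / q)"
  define v where "v = d powr (\<gamma> / q - s)"
  define q' where "q' = q / (q - 1)"
  have q': "q' > 1" "1 / q + 1 / q' = 1" using \<open>q > 1\<close> by (auto simp: q'_def divide_simps)
  have uv: "u \<ge> 0" "v \<ge> 0" using assms by (auto simp: u_def v_def)
  have "a * d powr -s = u * v"
    by (simp add: u_def v_def mult.assoc flip: powr_add)
  also have "\<dots> \<le> u powr q / q + v powr q' / q'"
    using Youngs_inequality[of q q' u v] q' uv \<open>q > 1\<close> by simp
  also have "\<dots> \<le> u powr q + v powr q'"
    using q' \<open>q > 1\<close> divide_left_mono[of 1 q "u powr q"] divide_left_mono[of 1 q' "v powr q'"]
    by (intro add_mono) auto
  also have "u powr q = a powr q * d powr -\<gamma>"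
    using assms by (simp add: u_def powr_mult powr_powr)
  also have "v powr q' = d powr - ((q * s - \<gamma>) / (q - 1))"
  proof -
    have "(\<gamma> / q - s) * q' = - ((q * s - \<gamma>) / (q - 1))"
      using \<open>q > 1\<close> by (simp add: q'_def divide_simps)
    then show ?thesis by (simp add: v_def powr_powr)
  qed
  finally show ?thesis .
qed

text \<open>
  Off the diagonal this integrand agrees with that of the class. On it the one with \<^const>\<open>powr\<close> is 0, hence the
  smaller one in any case.
\<close>

lemma M_class_integral_bound:
  fixes m :: "'a::metric_space measure"
  assumes "f \<in> M_class m \<nu> \<alpha> q"
  obtains M where "\<And>x. (\<integral>\<^sup>+y\<in>{y. dist x y \<le> 1}.
      ennreal (\<bar>f y\<bar> powr q * dist x y powr - (\<nu> - \<alpha>)) \<partial>m) \<le> ennreal M"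
proof -
  define S where "S = (SUP x. \<integral>\<^sup>+y\<in>{y. dist x y \<le> 1}.
        ennreal (\<bar>f y\<bar> powr q) / epowr (ennreal (dist x y)) (\<nu> - \<alpha>) \<partial>m)"
  have "S < \<infinity>" using assms by (simp add: S_def M_class_def)
  have "(\<integral>\<^sup>+y\<in>{y. dist x y \<le> 1}. ennreal (\<bar>f y\<bar> powr q * dist x y powr - (\<nu> - \<alpha>)) \<partial>m)
      \<le> ennreal (enn2real S)" for x
  proof -
    have le: "ennreal (\<bar>f y\<bar> powr q * dist x y powr - (\<nu> - \<alpha>))
        \<le> ennreal (\<bar>f y\<bar> powr q) / epowr (ennreal (dist x y)) (\<nu> - \<alpha>)" for y
    proof (cases "x = y")
      case False
      then have "epowr (ennreal (dist x y)) (\<nu> - \<alpha>) = ennreal (dist x y powr (\<nu> - \<alpha>))"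
        by (auto simp: epowr_def)
      then show ?thesis using False
        by (simp add: divide_ennreal powr_minus_divide del: minus_diff_eq)
    qed auto
    have "(\<integral>\<^sup>+y\<in>{y. dist x y \<le> 1}. ennreal (\<bar>f y\<bar> powr q * dist x y powr - (\<nu> - \<alpha>)) \<partial>m)
      \<le> (\<integral>\<^sup>+y\<in>{y. dist x y \<le> 1}.
        ennreal (\<bar>f y\<bar> powr q) / epowr (ennreal (dist x y)) (\<nu> - \<alpha>) \<partial>m)"
      by (intro nn_integral_mono mult_right_mono le) auto
    also have "\<dots> \<le> S" unfolding S_def by (intro SUP_upper) auto
    also have "S = ennreal (enn2real S)" using \<open>S < \<infinity>\<close> by simp
    finally show ?thesis by blast
  qed
  then show thesis by (rule that)
qed

text \<open>
  For \<open>q = 1\<close> the borderline \<open>s + \<alpha> = \<nu>\<close> is admitted, since the comparison with the weight of the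
  class is pointwise on the unit ball. The case \<open>s = 0\<close>, \<open>\<alpha> = \<nu>\<close> does occur in the theorem.
\<close>

lemma M_class_potential_bounded:
  fixes m :: "'a::metric_space measure"
  assumes sets: "sets m = sets borel"
    and growth: "ball_growth m \<nu> C"
    and f: "f \<in> M_class m \<nu> \<alpha> q"
    and s: "q = 1 \<and> s + \<alpha> \<le> \<nu> \<or> q > 1 \<and> s + \<alpha> / q < \<nu>"
  obtains K where
    "\<And>x. (\<integral>\<^sup>+y\<in>{y. dist x y \<le> 1}. ennreal (\<bar>f y\<bar> * dist x y powr -s) \<partial>m) \<le> ennreal K"
proof -
  have [measurable]: "f \<in> borel_measurable m"
    using f measurable_cong_sets[OF sets refl] unfolding M_class_def by blast
  have [measurable]: "(\<lambda>y. dist x y) \<in> borel_measurable m" for x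
    by (rule borel_measurable_dist_from[OF sets])
  obtain M where M: "\<And>x. (\<integral>\<^sup>+y\<in>{y. dist x y \<le> 1}.
      ennreal (\<bar>f y\<bar> powr q * dist x y powr - (\<nu> - \<alpha>)) \<partial>m) \<le> ennreal M"
    using M_class_integral_bound[OF f] by blast
  from s show thesis
  proof
    assume *: "q = 1 \<and> s + \<alpha> \<le> \<nu>"
    have "(\<integral>\<^sup>+y\<in>{y. dist x y \<le> 1}. ennreal (\<bar>f y\<bar> * dist x y powr -s) \<partial>m) \<le> ennreal M" for x
    proof -
      have "(\<integral>\<^sup>+y\<in>{y. dist x y \<le> 1}. ennreal (\<bar>f y\<bar> * dist x y powr -s) \<partial>m)
        \<le> (\<integral>\<^sup>+y\<in>{y. dist x y \<le> 1}. ennreal (\<bar>f y\<bar> powr q * dist x y powr - (\<nu> - \<alpha>)) \<partial>m)"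
        using * by (intro nn_integral_mono)
          (auto simp: indicator_def intro!: ennreal_leI mult_left_mono powr_mono')
      then show ?thesis using M order_trans by blast
    qed
    then show thesis by (rule that)
  next
    assume *: "q > 1 \<and> s + \<alpha> / q < \<nu>"
    define e where "e = (q * s - (\<nu> - \<alpha>)) / (q - 1)"
    \<comment> \<open>The exponent left over by Young's inequality is subcritical exactly under the condition on \<open>s\<close>.\<close>
    have "q * s + \<alpha> < q * \<nu>" using * by (auto simp: field_simps)
    then have "e < \<nu>" using * by (simp add: e_def pos_divide_less_eq algebra_simps)
    from nn_integral_dist_powr_bounded[OF sets this growth]
    obtain L where L: "\<And>x. (\<integral>\<^sup>+y\<in>{y. dist x y \<le> 1}. ennreal (dist x y powr -e) \<partial>m) \<le> ennreal L"
      by blast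
    \<comment> \<open>\<^const>\<open>ennreal\<close> is additive on nonnegative reals only, hence the truncation of the bounds at 0.\<close>
    have "(\<integral>\<^sup>+y\<in>{y. dist x y \<le> 1}. ennreal (\<bar>f y\<bar> * dist x y powr -s) \<partial>m)
        \<le> ennreal (max M 0 + max L 0)" for x
    proof -
      have pt: "ennreal (\<bar>f y\<bar> * dist x y powr -s)
          \<le> ennreal (\<bar>f y\<bar> powr q * dist x y powr - (\<nu> - \<alpha>)) + ennreal (dist x y powr -e)" for y
      proof (cases "x = y")
        case False
        then show ?thesis
          using young_weight_split[of "\<bar>f y\<bar>" "dist x y" q s "\<nu> - \<alpha>"] *
          by (simp add: e_def flip: ennreal_plus)
      qed auto
      have "(\<integral>\<^sup>+y\<in>{y. dist x y \<le> 1}. ennreal (\<bar>f y\<bar> * dist x y powr -s) \<partial>m)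
          \<le> (\<integral>\<^sup>+y. ennreal (\<bar>f y\<bar> powr q * dist x y powr - (\<nu> - \<alpha>)) * indicator {y. dist x y \<le> 1} y
                + ennreal (dist x y powr -e) * indicator {y. dist x y \<le> 1} y \<partial>m)"
        using pt by (intro nn_integral_mono) (auto simp: indicator_def)
      also have "\<dots> = (\<integral>\<^sup>+y\<in>{y. dist x y \<le> 1}. ennreal (\<bar>f y\<bar> powr q * dist x y powr - (\<nu> - \<alpha>)) \<partial>m)
          + (\<integral>\<^sup>+y\<in>{y. dist x y \<le> 1}. ennreal (dist x y powr -e) \<partial>m)"
        by (intro nn_integral_add) measurable
      also have "\<dots> \<le> ennreal (max M 0) + ennreal (max L 0)"
        by (intro add_mono order_trans[OF M] order_trans[OF L] ennreal_leI) auto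
      finally show ?thesis by simp
    qed
    then show thesis by (rule that)
  qed
qed

section \<open>The kernel near the diagonal\<close>

text \<open>
  In the critical case \<open>\<nu> = \<beta>\<close> a logarithm is dominated by any power: applying
  \<open>ln u \<le> u - 1\<close> to \<open>u = d powr -(t / p)\<close> gives \<open>ln (1 / d) \<le> p / t * d powr -(t / p)\<close>, and the
  exponent \<open>t / p\<close> becomes \<open>t\<close> after taking the \<open>p\<close>-th power.
\<close>

lemma kato_G_powr_le:
  assumes "p \<ge> 1" "t > 0" "\<beta> \<le> \<nu>"
  obtains K where "K \<ge> 0" and "\<And>d. 0 < d \<Longrightarrow> d < 1 \<Longrightarrow>
    epowr (kato_G \<nu> \<beta> d) p \<le> ennreal (K * d powr - (p * (\<nu> - \<beta>) + t))"
proof (cases "\<nu> > \<beta>")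
  case True
  have "epowr (kato_G \<nu> \<beta> d) p \<le> ennreal (1 * d powr - (p * (\<nu> - \<beta>) + t))" if "0 < d" "d < 1" for d
  proof -
    have "epowr (kato_G \<nu> \<beta> d) p = ennreal (d powr ((\<beta> - \<nu>) * p))"
      using that True assms by (simp add: epowr_def kato_G_def powr_powr)
    also have "\<dots> \<le> ennreal (d powr - (p * (\<nu> - \<beta>) + t))"
      using that assms by (intro ennreal_leI powr_mono') (auto simp: algebra_simps)
    finally show ?thesis by simp
  qed
  then show ?thesis by (intro that[of 1]) auto
next
  case False
  then have eq: "\<nu> = \<beta>" using assms by simp
  have "epowr (kato_G \<nu> \<beta> d) p \<le> ennreal ((p / t) powr p * d powr - (p * (\<nu> - \<beta>) + t))"
    if "0 < d" "d < 1" for d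
  proof -
    have pos: "ln (1 / d) > 0" using that by simp
    have "ln (1 / d) = p / t * ln (d powr - (t / p))"
      using that assms by (simp add: ln_powr ln_div)
    also have "\<dots> \<le> p / t * d powr - (t / p)"
      using that assms by (intro mult_left_mono order_trans[OF ln_le_minus_one]) auto
    finally have "ln (1 / d) powr p \<le> (p / t * d powr - (t / p)) powr p"
      using pos assms by (intro powr_mono2) auto
    also have "\<dots> = (p / t) powr p * d powr - t"
      using that assms by (subst powr_mult) (auto simp: powr_powr)
    finally show ?thesis
      using that pos assms by (simp add: epowr_def kato_G_def eq ennreal_leI)
  qed
  then show ?thesis by (intro that[of "(p / t) powr p"]) auto
qed

section \<open>Membership in the Kato class\<close>

theorem theorem4p5:
  fixes m :: "'a::metric_space measure"
    and V :: "real \<Rightarrow> real"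
    and \<nu> \<beta> p \<alpha> q :: real
    and f :: "'a \<Rightarrow> real"
  assumes "locally_compact_space (euclidean :: 'a topology)"
    and "separable_space (euclidean :: 'a topology)"
    and "radon_measure m"
    and "full_support m"
    and "\<nu> > 0" and "\<beta> > 0" and "p \<ge> 1"
    and "\<nu> - p * (\<nu> - \<beta>) > 0"
    and "\<alpha> > 0"
    and "bishop_inequality m \<nu> V"
    and "(\<nu> \<ge> \<alpha> \<and> q \<ge> 1) \<or> (\<nu> < \<alpha> \<and> q > \<alpha> / \<nu>)"
    and "f \<in> M_class m \<nu> \<alpha> q"
    and "q > \<alpha> / (\<nu> - p * (\<nu> - \<beta>))"
  shows "density m (\<lambda>x. ennreal \<bar>f x\<bar>) \<in> kato_class \<nu> \<beta> p"
proof -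
  define \<mu> where "\<mu> = density m (\<lambda>x. ennreal \<bar>f x\<bar>)"
  have sets: "sets m = sets borel" using \<open>radon_measure m\<close> by (simp add: radon_measure_def)
  then have sets_mu: "sets \<mu> = sets borel" by (simp add: \<mu>_def)
  obtain C where growth: "ball_growth m \<nu> C"
    using bishop_growth_bound[OF \<open>bishop_inequality m \<nu> V\<close>] by blast
  note bounded = M_class_potential_bounded[OF sets growth \<open>f \<in> M_class m \<nu> \<alpha> q\<close>]
  have [measurable]: "f \<in> borel_measurable m"
    using \<open>f \<in> M_class m \<nu> \<alpha> q\<close> measurable_cong_sets[OF sets refl] unfolding M_class_def by blast
  have [measurable]: "(\<lambda>y. dist x y) \<in> borel_measurable m" for x
    by (rule borel_measurable_dist_from[OF sets])
  have AE_neq: "AE y in \<mu>. y \<noteq> x" for x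
  proof -
    have "{x} \<in> null_sets m"
      using emeasure_singleton_zero_of_growth[OF sets \<open>\<nu> > 0\<close> growth, of x] sets by auto
    then have "AE y in m. y \<noteq> x" using AE_not_in by fastforce
    then show ?thesis unfolding \<mu>_def by (subst AE_density) auto
  qed
  have int_mu: "(\<integral>\<^sup>+y\<in>{y. dist x y \<le> 1}. ennreal (dist x y powr -s) \<partial>\<mu>)
      = (\<integral>\<^sup>+y\<in>{y. dist x y \<le> 1}. ennreal (\<bar>f y\<bar> * dist x y powr -s) \<partial>m)" for x s
    unfolding \<mu>_def by (subst nn_integral_density) (auto simp: ennreal_mult mult.assoc)
  have "q \<ge> 1"
    using assms(11)
  proof (elim disjE conjE)
    assume "\<nu> < \<alpha>" "\<alpha> / \<nu> < q"
    moreover have "1 < \<alpha> / \<nu>" using \<open>\<nu> < \<alpha>\<close> \<open>\<nu> > 0\<close> by simp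
    ultimately show ?thesis by linarith
  qed
  show ?thesis
  proof (cases "\<nu> \<ge> \<beta>")
    case True
    have "\<alpha> / q < \<nu> - p * (\<nu> - \<beta>)"
      using assms(8,13) \<open>q \<ge> 1\<close> by (simp add: field_simps)
    \<comment> \<open>A third of the available gap: two thirds are spent below, and the rest keeps the inequality strict.\<close>
    moreover define \<delta> where "\<delta> = (\<nu> - p * (\<nu> - \<beta>) - \<alpha> / q) / 3"
    ultimately have "\<delta> > 0" and \<delta>: "p * (\<nu> - \<beta>) + 2 * \<delta> + \<alpha> / q < \<nu>"
      by simp_all
    define s where "s = p * (\<nu> - \<beta>) + 2 * \<delta>"
    have "q = 1 \<and> s + \<alpha> \<le> \<nu> \<or> q > 1 \<and> s + \<alpha> / q < \<nu>"
      using \<delta> \<open>q \<ge> 1\<close> by (auto simp: s_def)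
    from bounded[OF this] obtain L where
      L: "\<And>x. (\<integral>\<^sup>+y\<in>{y. dist x y \<le> 1}. ennreal (dist x y powr -s) \<partial>\<mu>) \<le> ennreal L"
      unfolding int_mu by blast
    obtain K where "K \<ge> 0" and K: "\<And>d. 0 < d \<Longrightarrow> d < 1 \<Longrightarrow>
        epowr (kato_G \<nu> \<beta> d) p \<le> ennreal (K * d powr - (p * (\<nu> - \<beta>) + \<delta>))"
      using kato_G_powr_le[OF \<open>p \<ge> 1\<close> \<open>\<delta> > 0\<close> True] by blast
    define F where "F = (\<lambda>r. SUP x. \<integral>\<^sup>+y\<in>{y. dist x y < r}. epowr (kato_G \<nu> \<beta> (dist x y)) p \<partial>\<mu>)"
    have F: "F r \<le> ennreal (K * r powr \<delta> * L)" if r: "r \<in> {0<..<1}" for r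
      unfolding F_def
    proof (intro SUP_least)
      fix x
      have "(\<integral>\<^sup>+y\<in>{y. dist x y < r}. epowr (kato_G \<nu> \<beta> (dist x y)) p \<partial>\<mu>)
          \<le> (\<integral>\<^sup>+y. ennreal (K * r powr \<delta>) * (ennreal (dist x y powr -s) * indicator {y. dist x y \<le> 1} y) \<partial>\<mu>)"
      proof (rule nn_integral_mono_AE, use AE_neq[of x] in eventually_elim)
        case (elim y)
        show ?case
        proof (cases "dist x y < r")
          case True
          have "epowr (kato_G \<nu> \<beta> (dist x y)) p \<le> ennreal (K * dist x y powr - (p * (\<nu> - \<beta>) + \<delta>))"
            using True elim r by (intro K) auto
          \<comment> \<open>One \<open>\<delta>\<close> is traded for smallness in \<open>r\<close>, while \<open>d powr -s\<close> stays integrable against \<open>\<mu>\<close>.\<close>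
          also have "dist x y powr - (p * (\<nu> - \<beta>) + \<delta>) = dist x y powr \<delta> * dist x y powr -s"
            by (simp add: s_def algebra_simps flip: powr_add)
          also have "ennreal (K * \<dots>) \<le> ennreal (K * (r powr \<delta> * dist x y powr -s))"
            using True \<open>K \<ge> 0\<close> \<open>\<delta> > 0\<close>
            by (intro ennreal_leI mult_left_mono mult_right_mono powr_mono2) auto
          finally show ?thesis using True r \<open>K \<ge> 0\<close> by (simp add: ennreal_mult mult.assoc)
        qed auto
      qed
      also have "\<dots> = ennreal (K * r powr \<delta>) * (\<integral>\<^sup>+y\<in>{y. dist x y \<le> 1}. ennreal (dist x y powr -s) \<partial>\<mu>)"
        unfolding \<mu>_def by (intro nn_integral_cmult) measurable
      also have "\<dots> \<le> ennreal (K * r powr \<delta>) * ennreal L"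
        by (intro mult_left_mono L) auto
      also have "\<dots> = ennreal (K * r powr \<delta> * L)"
        using \<open>K \<ge> 0\<close> by (simp add: ennreal_mult')
      finally show "(\<integral>\<^sup>+y\<in>{y. dist x y < r}. epowr (kato_G \<nu> \<beta> (dist x y)) p \<partial>\<mu>)
          \<le> ennreal (K * r powr \<delta> * L)" .
    qed
    have "((\<lambda>r. ennreal (K * r powr \<delta> * L)) \<longlongrightarrow> ennreal (K * 0 powr \<delta> * L)) (at_right 0)"
      using \<open>\<delta> > 0\<close>
      by (intro tendsto_intros tendsto_ennrealI) (auto intro: eventually_at_rightI[of 0 1])
    then have "((\<lambda>r. ennreal (K * r powr \<delta> * L)) \<longlongrightarrow> 0) (at_right 0)" by simp
    then have "(F \<longlongrightarrow> 0) (at_right 0)"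
      by (rule tendsto_sandwich[OF _ _ tendsto_const, rotated 2])
         (auto intro: eventually_at_rightI[of 0 1] F)
    then show ?thesis
      using True sets_mu by (simp add: kato_class_def F_def \<mu>_def)
  next
    case False
    have "q = 1 \<and> 0 + \<alpha> \<le> \<nu> \<or> q > 1 \<and> 0 + \<alpha> / q < \<nu>"
    proof (cases "q = 1")
      case True
      then show ?thesis using assms(5,11) by (auto simp: field_simps)
    next
      case False
      then have "q > 1" using \<open>q \<ge> 1\<close> by simp
      moreover have "\<alpha> < \<nu> * q"
        using assms(5,11)
      proof (elim disjE conjE)
        assume "\<alpha> \<le> \<nu>"
        also have "\<nu> < \<nu> * q" using \<open>q > 1\<close> \<open>\<nu> > 0\<close> by simp
        finally show ?thesis .
      qed (simp add: field_simps)
      ultimately show ?thesis by (simp add: field_simps)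
    qed
    from bounded[OF this] obtain L where
      L: "\<And>x. (\<integral>\<^sup>+y\<in>{y. dist x y \<le> 1}. ennreal (dist x y powr -0) \<partial>\<mu>) \<le> ennreal L"
      unfolding int_mu by blast
    \<comment> \<open>\<open>d powr 0\<close> equals 1 only off the diagonal, hence the comparison almost everywhere.\<close>
    have "(\<integral>\<^sup>+y\<in>{y. dist x y \<le> 1}. 1 \<partial>\<mu>) \<le> ennreal L" for x
    proof -
      have "(\<integral>\<^sup>+y\<in>{y. dist x y \<le> 1}. 1 \<partial>\<mu>)
          \<le> (\<integral>\<^sup>+y\<in>{y. dist x y \<le> 1}. ennreal (dist x y powr -0) \<partial>\<mu>)"
        by (rule nn_integral_mono_AE, use AE_neq[of x] in eventually_elim) auto
      also note L
      finally show ?thesis .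
    qed
    then have "(SUP x. \<integral>\<^sup>+y\<in>{y. dist x y \<le> 1}. 1 \<partial>\<mu>) \<le> ennreal L"
      by (intro SUP_least)
    then have "(SUP x. \<integral>\<^sup>+y\<in>{y. dist x y \<le> 1}. 1 \<partial>\<mu>) < \<infinity>"
      by (rule le_less_trans) simp
    then show ?thesis
      using False sets_mu by (simp add: kato_class_def \<mu>_def)
  qed
qed

end
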